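(* Let $T>0$, $e\in\mathbb R$ and $N\ge 0$. The modified matrix $$\overline D_{11}^N=D_{11}^N+(A_{11}^N)^{-1}A_{12}^ND_{21}^N\in\mathbb R^{(N+1)\times(N+1)}$$ is skew-symmetric with respect to the truncated Gram matrix, that is $$A_{11}^N\,\overline D_{11}^N+(\overline D_{11}^N)^T A_{11}^N=0 .$$
   Context: $\mathbb N=\{0,1,2,\dots\}$; rows and columns are indexed from $0$. $H_m$ denotes the (physicists') Hermite polynomial, $H_m(x)=(-1)^m e^{x^2}\frac{d^m}{dx^m}e^{-x^2}$. For fixed $T>0$ the asymmetric Hermite functions are $\psi_m(v)=e^{-v^2/T}T^{-\frac12}(2^m m!\sqrt{\pi})^{-\frac12}H_m(v/\sqrt T)$, and the infinite Gram matrix is $A=(a_{mn})_{m,n\ge0}$, $a_{mn}=\int_{\mathbb R}\psi_m\psi_n\,dv$. The infinite matrix $D=(d_{mn})_{m,n\ge0}$ has $d_{mn}=-e\sqrt{\frac{2m}{T}}\,\delta_{m-1,n}$. For given $N$ the matrices are split in blocks according to the indices $\{0,\dots,N\}$ and $\{N+1,N+2,\dots\}$: $A_{11}^N=(a_{mn})_{0\le m,n\le N}$ (which is invertible), $A_{12}^N=(a_{mn})_{0\le m\le N,\;n\ge N+1}$, $D_{11}^N=(d_{mn})_{0\le m,n\le N}$, $D_{21}^N=(d_{mn})_{m\ge N+1,\;0\le n\le N}$. Each column of $D_{21}^N$ has at most one nonzero entry, so the product $A_{12}^ND_{21}^N$ is well defined. *)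

theory Defs
  imports
    "HOL-Analysis.Analysis"
    "Jordan_Normal_Form.Gauss_Jordan_Elimination"
begin

definition hermite :: "nat \<Rightarrow> real \<Rightarrow> real" where
  "hermite m x = (- 1) ^ m * exp (x\<^sup>2) * (deriv ^^ m) (\<lambda>y. exp (- y\<^sup>2)) x"

definition herm_fun :: "real \<Rightarrow> nat \<Rightarrow> real \<Rightarrow> real" where
  "herm_fun T m v =
     exp (- v\<^sup>2 / T) * T powr (- 1 / 2) * (2 ^ m * fact m * sqrt pi) powr (- 1 / 2)
       * hermite m (v / sqrt T)"

definition gram :: "real \<Rightarrow> nat \<Rightarrow> nat \<Rightarrow> real" where
  "gram T m n = (\<integral>v. herm_fun T m v * herm_fun T n v \<partial>lborel)"

(* The parameter e is an arbitrary real number, not Euler's constant. The Kronecker delta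
   of m - 1 and n is taken over the integers, so row 0 vanishes; truncated subtraction on
   nat is avoided by testing m = n + 1. *)
definition dcoef :: "real \<Rightarrow> real \<Rightarrow> nat \<Rightarrow> nat \<Rightarrow> real" where
  "dcoef e T m n = - e * sqrt (2 * real m / T) * (if m = n + 1 then 1 else 0)"

definition A11 :: "real \<Rightarrow> nat \<Rightarrow> real mat" where
  "A11 T N = mat (N + 1) (N + 1) (\<lambda>(m, n). gram T m n)"

definition D11 :: "real \<Rightarrow> real \<Rightarrow> nat \<Rightarrow> real mat" where
  "D11 e T N = mat (N + 1) (N + 1) (\<lambda>(m, n). dcoef e T m n)"

(* Product of the (N+1) x infinity block of A by the infinity x (N+1) block of D: the inner
   index runs over all k > N. By A12_D21_support only finitely many terms are nonzero. *)
definition A12_D21 :: "real \<Rightarrow> real \<Rightarrow> nat \<Rightarrow> real mat" where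
  "A12_D21 e T N =
     mat (N + 1) (N + 1) (\<lambda>(m, n). \<Sum>\<^sub>\<infinity>k\<in>{N + 1..}. gram T m k * dcoef e T k n)"

lemma A12_D21_support: "{k \<in> {N + 1..}. gram T m k * dcoef e T k n \<noteq> 0} \<subseteq> {n + 1}"
  by (auto simp: dcoef_def)

lemma A12_D21_summable: "(\<lambda>k. gram T m k * dcoef e T k n) summable_on {N + 1..}"
proof -
  have "(\<lambda>k. gram T m k * dcoef e T k n) summable_on ({N + 1..} \<inter> {n + 1})"
    by (rule summable_on_finite) auto
  then show ?thesis
    by (rule summable_on_cong_neutral[THEN iffD1, rotated -1]) (auto simp: dcoef_def)
qed

(* mat_inverse returns Some of the two-sided inverse exactly when the matrix is invertible. *)
definition D11_bar :: "real \<Rightarrow> real \<Rightarrow> nat \<Rightarrow> real mat" where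
  "D11_bar e T N = D11 e T N + the (mat_inverse (A11 T N)) * A12_D21 e T N"

end

theory Submission
  imports Defs
    "HOL-Probability.Distributions"
    "HOL-Real_Asymp.Real_Asymp"
    "Jordan_Normal_Form.Determinant"
begin

text \<open>
  Up to sign and normalisation \<open>\<psi>\<^sub>m\<close> is the \<open>m\<close>-th derivative of a Gaussian, so
  \<open>\<psi>\<^sub>m' = - sqrt (2 (m + 1) / T) \<psi>\<^sub>m\<^sub>+\<^sub>1\<close>. The correction term completes the truncated product
  \<open>A\<^sub>1\<^sub>1 D\<^sub>1\<^sub>1\<close> to the leading block of the infinite product \<open>A D\<close>, whose \<open>(m, n)\<close> entry is
  \<open>e \<integral> \<psi>\<^sub>m \<psi>\<^sub>n'\<close>; it is skew-symmetric by integration by parts. The Gram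
  matrix is invertible because the \<open>\<psi>\<^sub>m\<close> are linearly independent.
\<close>

section \<open>Derivatives of the Gaussian and their polynomial factors\<close>

text \<open>These are \<open>(-1)^n\<close> times the Hermite polynomials; the recursion is what
  differentiating \<open>p(x) exp(-x^2)\<close> does to the factor \<open>p\<close>.\<close>

primrec gauss_poly :: "nat \<Rightarrow> real poly" where
  "gauss_poly 0 = 1"
| "gauss_poly (Suc n) = pderiv (gauss_poly n) - [:0, 2:] * gauss_poly n"

definition gauss_deriv :: "nat \<Rightarrow> real \<Rightarrow> real" where
  "gauss_deriv n x = poly (gauss_poly n) x * exp (- x\<^sup>2)"

lemma has_real_derivative_gauss_deriv:
  "(gauss_deriv n has_real_derivative gauss_deriv (Suc n) x) (at x)"
proof -
  have "((\<lambda>x. poly (gauss_poly n) x * exp (- x\<^sup>2)) has_real_derivative gauss_deriv (Suc n) x) (at x)"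
    by (auto intro!: derivative_eq_intros simp: gauss_deriv_def algebra_simps)
  then show ?thesis
    by (simp add: gauss_deriv_def[abs_def])
qed

lemma funpow_deriv_gauss: "(deriv ^^ n) (\<lambda>y::real. exp (- y\<^sup>2)) = gauss_deriv n"
proof (induction n)
  case 0
  show ?case by (simp add: gauss_deriv_def fun_eq_iff)
next
  case (Suc n)
  then show ?case
    by (auto intro!: DERIV_imp_deriv has_real_derivative_gauss_deriv)
qed

lemma degree_gauss_poly_le: "degree (gauss_poly n) \<le> n"
proof (induction n)
  case (Suc n)
  have "degree ([:0, 2:] * gauss_poly n) \<le> degree [:0, 2::real:] + degree (gauss_poly n)"
    by (rule degree_mult_le)
  with Suc show ?case
    by (auto intro!: degree_diff_le simp: degree_pderiv)
qed simp

lemma coeff_gauss_poly: "coeff (gauss_poly n) n = (- 2) ^ n"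
proof (induction n)
  case (Suc n)
  have "coeff (pderiv (gauss_poly n)) (Suc n) = 0"
    using degree_gauss_poly_le[of n] by (intro coeff_eq_0) (simp add: degree_pderiv)
  with Suc show ?case by simp
qed simp

text \<open>The \<open>i\<close>-th polynomial has degree at most \<open>i\<close> and a nonzero
  coefficient there, so the top coefficient of a vanishing combination isolates the last
  \<open>c n\<close>; induction removes it.\<close>

lemma gauss_poly_independent:
  assumes "(\<Sum>i<n. Polynomial.smult (c i) (gauss_poly i)) = 0" "i < n"
  shows "c i = 0"
  using assms
proof (induction n)
  case (Suc n)
  have "coeff (\<Sum>i<Suc n. Polynomial.smult (c i) (gauss_poly i)) n
      = (\<Sum>i<n. c i * coeff (gauss_poly i) n) + c n * (- 2) ^ n"
    by (simp add: coeff_sum coeff_gauss_poly)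
  also have "(\<Sum>i<n. c i * coeff (gauss_poly i) n) = 0"
    using le_less_trans[OF degree_gauss_poly_le] by (intro sum.neutral) (simp add: coeff_eq_0)
  finally have "c n = 0"
    unfolding Suc.prems(1) by simp
  with Suc show ?case
    by (cases "i = n") auto
qed simp

section \<open>Integrability, decay and integration by parts\<close>

lemma integrable_poly_times_gauss:
  fixes p :: "real poly"
  shows "integrable lborel (\<lambda>x. poly p x * exp (- 2 * x\<^sup>2))"
proof -
  have "integrable lborel (\<lambda>x::real. x ^ k * exp (- 2 * x\<^sup>2))" for k
  proof -
    \<comment> \<open>The normal density with mean 0 and standard deviation 1/2 is
      \<open>sqrt (2 / pi) * exp (- 2 * x^2)\<close>, so the monomial terms are its moments up to a
      factor.\<close>
    have "integrable lborel (\<lambda>x. sqrt (pi / 2) * (normal_density 0 (1/2) x * (x - 0) ^ k))"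
      by (intro integrable_mult_right integrable_normal_moment) simp
    also have "(\<lambda>x. sqrt (pi / 2) * (normal_density 0 (1/2) x * (x - 0) ^ k))
        = (\<lambda>x. x ^ k * exp (- 2 * x\<^sup>2))"
      by (simp add: normal_density_def fun_eq_iff power2_eq_square)
    finally show ?thesis .
  qed
  then show ?thesis
    by (simp add: poly_altdef sum_distrib_right mult.assoc)
qed

lemma tendsto_poly_times_gauss:
  fixes p :: "real poly"
  shows "((\<lambda>x. poly p x * exp (- 2 * x\<^sup>2)) \<longlongrightarrow> 0) at_top"
proof -
  have "((\<lambda>x. x ^ k * exp (- 2 * x\<^sup>2)) \<longlongrightarrow> (0::real)) at_top" for k
    by real_asymp
  then have "((\<lambda>x. \<Sum>i\<le>degree p. coeff p i * (x ^ i * exp (- 2 * x\<^sup>2))) \<longlongrightarrow> 0) at_top"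
    by (intro tendsto_null_sum tendsto_mult_right_zero)
  then show ?thesis
    by (simp add: poly_altdef sum_distrib_right mult.assoc)
qed

lemma tendsto_poly_times_gauss_at_bot:
  fixes p :: "real poly"
  shows "((\<lambda>x. poly p x * exp (- 2 * x\<^sup>2)) \<longlongrightarrow> 0) at_bot"
  using tendsto_poly_times_gauss[of "pcompose p [:0, -1:]"]
  by (simp add: filterlim_at_bot_mirror poly_pcompose)

lemma gauss_deriv_mult:
  "gauss_deriv m x * gauss_deriv n x = poly (gauss_poly m * gauss_poly n) x * exp (- 2 * x\<^sup>2)"
  by (simp add: gauss_deriv_def flip: exp_add)

lemma integrable_gauss_deriv_mult:
  "integrable lborel (\<lambda>x. gauss_deriv m x * gauss_deriv n x)"
  unfolding gauss_deriv_mult by (rule integrable_poly_times_gauss)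

lemma integral_gauss_deriv_by_parts:
  "(\<integral>x. gauss_deriv (Suc m) x * gauss_deriv n x \<partial>lborel)
    = - (\<integral>x. gauss_deriv m x * gauss_deriv (Suc n) x \<partial>lborel)"
proof -
  let ?F = "\<lambda>x. gauss_deriv m x * gauss_deriv n x"
  let ?f = "\<lambda>x. gauss_deriv (Suc m) x * gauss_deriv n x + gauss_deriv m x * gauss_deriv (Suc n) x"
  have cont: "isCont (gauss_deriv k) x" for k x
    using has_real_derivative_gauss_deriv by (rule DERIV_isCont)
  have int: "integrable lborel ?f"
    by (intro Bochner_Integration.integrable_add integrable_gauss_deriv_mult)
  \<comment> \<open>The two zeros are the limits of \<open>?F\<close> at the ends of the line, where
    the Gaussian beats every polynomial.\<close>
  have "(LBINT x=-\<infinity>..\<infinity>. ?f x) = 0 - 0"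
  proof (rule interval_integral_FTC_integrable)
    show "(?F has_vector_derivative ?f x) (at x)" for x
      by (auto intro!: derivative_eq_intros has_real_derivative_gauss_deriv
          simp flip: has_real_derivative_iff_has_vector_derivative)
    show "isCont ?f x" for x
      by (intro continuous_intros cont)
    show "set_integrable lborel (einterval (-\<infinity>) \<infinity>) ?f"
      using int by (simp add: set_integrable_def)
    show "((?F \<circ> real_of_ereal) \<longlongrightarrow> 0) (at_right (-\<infinity>))"
      unfolding ereal_tendsto_simps gauss_deriv_mult
      by (rule tendsto_poly_times_gauss_at_bot)
    show "((?F \<circ> real_of_ereal) \<longlongrightarrow> 0) (at_left \<infinity>)"
      unfolding ereal_tendsto_simps gauss_deriv_mult
      by (rule tendsto_poly_times_gauss)
  qed simp
  then have "(\<integral>x. ?f x \<partial>lborel) = 0"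
    by (simp add: interval_lebesgue_integral_def set_lebesgue_integral_def)
  then show ?thesis
    by (simp add: integrable_gauss_deriv_mult)
qed

section \<open>Hermite functions as rescaled Gaussian derivatives\<close>

text \<open>The constant between \<open>herm_fun T m v\<close> and
  \<open>gauss_deriv m (v / sqrt T)\<close>; its sign comes from the definition of the Hermite
  polynomials.\<close>

definition herm_weight :: "real \<Rightarrow> nat \<Rightarrow> real" where
  "herm_weight T m = (- 1) ^ m * T powr (- 1 / 2) * (2 ^ m * fact m * sqrt pi) powr (- 1 / 2)"

lemma herm_weight_nonzero: "T > 0 \<Longrightarrow> herm_weight T m \<noteq> 0"
  by (simp add: herm_weight_def)

text \<open>The normalisation \<open>2^m m! sqrt pi\<close> grows by the factor
  \<open>2 (m + 1)\<close> and enters with exponent -1/2; the alternating sign gives the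
  minus.\<close>

lemma herm_weight_Suc: "herm_weight T (Suc m) * sqrt (2 * real (Suc m)) = - herm_weight T m"
proof -
  have "(2 ^ Suc m * fact (Suc m) * sqrt pi) powr (- 1 / 2) * sqrt (2 * real (Suc m))
      = (2 ^ m * fact m * sqrt pi) powr (- 1 / 2)"
  proof -
    have "2 ^ Suc m * fact (Suc m) * sqrt pi = (2 * real (Suc m)) * (2 ^ m * fact m * sqrt pi)"
      by (simp add: algebra_simps)
    moreover have "(2 * real (Suc m)) powr (- 1 / 2) * sqrt (2 * real (Suc m)) = 1"
      by (simp add: powr_minus powr_half_sqrt)
    ultimately show ?thesis
      by (simp only: powr_mult mult_ac) simp
  qed
  then show ?thesis
    by (simp add: herm_weight_def mult.assoc)
qed

lemma herm_fun_eq: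
  assumes "T > 0"
  shows "herm_fun T m v = herm_weight T m * gauss_deriv m (v / sqrt T)"
proof -
  have "exp (- v\<^sup>2 / T) * exp ((v / sqrt T)\<^sup>2) = 1"
    using assms by (simp add: power_divide flip: exp_add)
  then show ?thesis
    by (simp add: herm_fun_def hermite_def herm_weight_def funpow_deriv_gauss algebra_simps)
qed

text \<open>The substitution \<open>v = sqrt T * x\<close> removes \<open>T\<close> from the
  integrand and contributes the factor \<open>sqrt T\<close>.\<close>

lemma gram_eq:
  assumes "T > 0"
  shows "gram T m n = sqrt T * herm_weight T m * herm_weight T n
    * (\<integral>x. gauss_deriv m x * gauss_deriv n x \<partial>lborel)"
proof -
  have "gram T m n = \<bar>sqrt T\<bar> *\<^sub>R
      (\<integral>x. herm_fun T m (0 + sqrt T * x) * herm_fun T n (0 + sqrt T * x) \<partial>lborel)"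
    unfolding gram_def using assms by (intro lborel_integral_real_affine) simp
  also have "(\<lambda>x. herm_fun T m (0 + sqrt T * x) * herm_fun T n (0 + sqrt T * x))
      = (\<lambda>x. herm_weight T m * herm_weight T n * (gauss_deriv m x * gauss_deriv n x))"
    using assms by (simp add: herm_fun_eq fun_eq_iff)
  finally show ?thesis
    using assms by simp
qed

lemma gram_commute: "gram T m n = gram T n m"
  by (simp add: gram_def mult.commute)

lemma gram_dcoef_skew:
  assumes "T > 0"
  shows "gram T m (Suc n) * dcoef e T (Suc n) n = - (gram T n (Suc m) * dcoef e T (Suc m) m)"
proof -
  \<comment> \<open>The factor \<open>sqrt T\<close> cancels against \<open>dcoef\<close>, and the
    recursion of the weights absorbs the remaining root. The prefactor becomes symmetric in
    \<open>m\<close> and \<open>n\<close>, so only integration by parts is left.\<close>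
  have *: "gram T m (Suc n) * dcoef e T (Suc n) n
      = e * herm_weight T m * herm_weight T n
        * (\<integral>x. gauss_deriv m x * gauss_deriv (Suc n) x \<partial>lborel)" for m n
  proof -
    have "gram T m (Suc n) * dcoef e T (Suc n) n
      = - e * herm_weight T m * (herm_weight T (Suc n) * sqrt (2 * real (Suc n)))
        * (\<integral>x. gauss_deriv m x * gauss_deriv (Suc n) x \<partial>lborel)"
      using assms by (simp add: gram_eq dcoef_def real_sqrt_divide)
    then show ?thesis
      by (simp only: herm_weight_Suc)
  qed
  show ?thesis
    unfolding * using integral_gauss_deriv_by_parts[of m n] by (simp add: mult_ac)
qed

section \<open>Invertibility of the truncated Gram matrix\<close>

text \<open>The form is the integral of \<open>?p^2\<close> against a positive weight. If it
  vanishes, \<open>?p\<close> is zero almost everywhere, hence zero, since a nonzero polynomial has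
  finitely many roots.\<close>

lemma quadratic_form_gauss_deriv_eq_0D:
  assumes "(\<Sum>i<n. \<Sum>j<n. c i * c j * (\<integral>x. gauss_deriv i x * gauss_deriv j x \<partial>lborel)) = 0" "i < n"
  shows "c i = 0"
proof -
  let ?p = "\<Sum>i<n. Polynomial.smult (c i) (gauss_poly i)"
  have eq: "poly (?p * ?p) x * exp (- 2 * x\<^sup>2)
      = (\<Sum>i<n. \<Sum>j<n. c i * c j * (gauss_deriv i x * gauss_deriv j x))" for x
    unfolding poly_mult poly_sum poly_smult sum_product gauss_deriv_mult
    unfolding sum_distrib_right by (simp only: mult_ac)
  have "(\<integral>x. poly (?p * ?p) x * exp (- 2 * x\<^sup>2) \<partial>lborel) = 0"
    unfolding eq using assms(1)
    by (simp add: integrable_gauss_deriv_mult)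
  then have "AE x in lborel. poly (?p * ?p) x * exp (- 2 * x\<^sup>2) = 0"
    using integral_nonneg_eq_0_iff_AE[OF integrable_poly_times_gauss[of "?p * ?p"]] by simp
  then have ae: "AE x in lborel. poly ?p x = 0"
    by simp
  have "?p = 0"
  proof (rule ccontr)
    assume "?p \<noteq> 0"
    then have "{x. poly ?p x = 0} \<in> null_sets lborel"
      by (intro finite_imp_null_set_lborel poly_roots_finite)
    then have "AE x in lborel. poly ?p x \<noteq> 0"
      by (rule AE_I') auto
    with ae have "AE x::real in lborel. False"
      by eventually_elim simp
    then show False
      by (simp add: eventually_False ae_filter_eq_bot_iff)
  qed
  from this assms(2) show ?thesis
    by (rule gauss_poly_independent)
qed

lemma A11_carrier: "A11 T N \<in> carrier_mat (N + 1) (N + 1)"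
  by (simp add: A11_def)

lemma A11_mult_vec_eq_0D:
  assumes "T > 0" "v \<in> carrier_vec (N + 1)" "A11 T N *\<^sub>v v = 0\<^sub>v (N + 1)"
  shows "v = 0\<^sub>v (N + 1)"
proof -
  let ?J = "\<lambda>i j. \<integral>x. gauss_deriv i x * gauss_deriv j x \<partial>lborel"
  \<comment> \<open>With the weights absorbed into the coefficients, \<open>v^T A v\<close> is
    \<open>sqrt T\<close> times the quadratic form of the Gaussian integrals.\<close>
  let ?c = "\<lambda>i. herm_weight T i * vec_index v i"
  have row: "(\<Sum>j<N+1. gram T i j * vec_index v j) = 0" if "i < N + 1" for i
  proof -
    have "vec_index (A11 T N *\<^sub>v v) i = (\<Sum>j<N+1. gram T i j * vec_index v j)"
      using that assms(2) by (simp add: A11_def scalar_prod_def atLeast0LessThan del: sum.lessThan_Suc)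
    then show ?thesis
      using that assms(3) by simp
  qed
  have "sqrt T * (\<Sum>i<N+1. \<Sum>j<N+1. ?c i * ?c j * ?J i j)
      = (\<Sum>i<N+1. vec_index v i * (\<Sum>j<N+1. gram T i j * vec_index v j))"
    unfolding sum_distrib_left using assms(1) by (simp only: gram_eq mult_ac)
  also have "\<dots> = 0"
    using row by (intro sum.neutral) simp
  finally have "(\<Sum>i<N+1. \<Sum>j<N+1. ?c i * ?c j * ?J i j) = 0"
    using assms(1) by simp
  then have "?c i = 0" if "i < N + 1" for i
    using that by (rule quadratic_form_gauss_deriv_eq_0D)
  then show ?thesis
    using assms(1,2) by (intro eq_vecI) (auto simp: herm_weight_nonzero)
qed

text \<open>A trivial kernel gives a nonzero determinant, so \<open>mat_inverse\<close> returns
  \<open>Some\<close> and \<open>the\<close> yields a true inverse.\<close>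

lemma A11_inverse:
  assumes "T > 0"
  shows "the (mat_inverse (A11 T N)) \<in> carrier_mat (N + 1) (N + 1)"
    and "A11 T N * the (mat_inverse (A11 T N)) = 1\<^sub>m (N + 1)"
proof -
  have "Determinant.det (A11 T N) \<noteq> 0"
    using det_0_iff_vec_prod_zero[OF A11_carrier] A11_mult_vec_eq_0D[OF assms] by blast
  then have "A11 T N \<in> Units (ring_mat TYPE(real) (N + 1) ())"
    by (rule det_non_zero_imp_unit[OF A11_carrier])
  then obtain B where "mat_inverse (A11 T N) = Some B"
    using mat_inverse(1)[OF A11_carrier, where b = "()"] by (cases "mat_inverse (A11 T N)") auto
  then show "the (mat_inverse (A11 T N)) \<in> carrier_mat (N + 1) (N + 1)"
    and "A11 T N * the (mat_inverse (A11 T N)) = 1\<^sub>m (N + 1)"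
    using mat_inverse(2)[OF A11_carrier] by auto
qed

section \<open>The leading block of the infinite product\<close>

text \<open>Only \<open>k = n + 1\<close> contributes, and it exceeds \<open>N\<close> just when
  \<open>N \<le> n\<close>; among the columns of the block this is the last one.\<close>

lemma A12_D21_entry:
  "(\<Sum>\<^sub>\<infinity>k\<in>{N + 1..}. gram T m k * dcoef e T k n)
    = (if N \<le> n then gram T m (Suc n) * dcoef e T (Suc n) n else 0)"
proof -
  have "(\<Sum>\<^sub>\<infinity>k\<in>{N + 1..}. gram T m k * dcoef e T k n)
      = (\<Sum>\<^sub>\<infinity>k\<in>{N + 1..} \<inter> {Suc n}. gram T m k * dcoef e T k n)"
    by (intro infsum_cong_neutral) (auto simp: dcoef_def)
  then show ?thesis
    by (cases "N \<le> n") auto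
qed

lemma A11_mult_D11_bar:
  assumes "T > 0"
  shows "A11 T N * D11_bar e T N
    = mat (N + 1) (N + 1) (\<lambda>(m, n). gram T m (Suc n) * dcoef e T (Suc n) n)"
proof -
  let ?I = "the (mat_inverse (A11 T N))"
  have carrier [simp]: "D11 e T N \<in> carrier_mat (N + 1) (N + 1)"
      "A12_D21 e T N \<in> carrier_mat (N + 1) (N + 1)"
    by (simp_all add: D11_def A12_D21_def)
  have "A11 T N * D11_bar e T N = A11 T N * D11 e T N + A11 T N * (?I * A12_D21 e T N)"
    unfolding D11_bar_def
    using A11_carrier carrier A11_inverse(1)[OF assms]
    by (intro mult_add_distrib_mat mult_carrier_mat)
  also have "A11 T N * (?I * A12_D21 e T N) = A12_D21 e T N"
    using assoc_mult_mat[OF A11_carrier[of T N] A11_inverse(1)[OF assms] carrier(2)]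
    unfolding A11_inverse(2)[OF assms] left_mult_one_mat[OF carrier(2)] by (rule sym)
  also have "A11 T N * D11 e T N + A12_D21 e T N
    = mat (N + 1) (N + 1) (\<lambda>(m, n). gram T m (Suc n) * dcoef e T (Suc n) n)"
  proof (rule eq_matI)
    fix m n
    assume "m < dim_row (mat (N + 1) (N + 1) (\<lambda>(m, n). gram T m (Suc n) * dcoef e T (Suc n) n))"
      and "n < dim_col (mat (N + 1) (N + 1) (\<lambda>(m, n). gram T m (Suc n) * dcoef e T (Suc n) n))"
    then have mn: "m < N + 1" "n < N + 1"
      by simp_all
    have "(A11 T N * D11 e T N) $$ (m, n) = (\<Sum>k<N+1. gram T m k * dcoef e T k n)"
      using mn by (simp add: A11_def D11_def scalar_prod_def atLeast0LessThan del: sum.lessThan_Suc)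
    also have "\<dots> = (\<Sum>k<N+1. if k = Suc n then gram T m (Suc n) * dcoef e T (Suc n) n else 0)"
      by (intro sum.cong) (auto simp: dcoef_def)
    \<comment> \<open>The index \<open>n + 1\<close> lies inside the truncation exactly for
      \<open>n < N\<close>; the missing column \<open>n = N\<close> is supplied by the correction
      term.\<close>
    also have "\<dots> = (if n < N then gram T m (Suc n) * dcoef e T (Suc n) n else 0)"
      by (simp del: sum.lessThan_Suc)
    finally show "(A11 T N * D11 e T N + A12_D21 e T N) $$ (m, n)
      = mat (N + 1) (N + 1) (\<lambda>(m, n). gram T m (Suc n) * dcoef e T (Suc n) n) $$ (m, n)"
      using mn by (simp add: A12_D21_def A12_D21_entry[folded Suc_eq_plus1] D11_def A11_def)
  qed (simp_all add: A11_def D11_def A12_D21_def)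
  finally show ?thesis .
qed

theorem lemma5p2:
  fixes T e :: real and N :: nat
  assumes "T > 0"
  shows "A11 T N * D11_bar e T N + transpose_mat (D11_bar e T N) * A11 T N = 0\<^sub>m (N + 1) (N + 1)"
proof -
  have "D11_bar e T N \<in> carrier_mat (N + 1) (N + 1)"
    using A11_inverse(1)[OF assms, of N] by (simp add: D11_bar_def D11_def A12_D21_def)
  moreover have "transpose_mat (A11 T N) = A11 T N"
    by (intro eq_matI) (auto simp: A11_def gram_commute)
  \<comment> \<open>As the Gram matrix is symmetric, the second summand is the transpose of the
    first, and \<open>gram_dcoef_skew\<close> makes their entries cancel.\<close>
  ultimately have "transpose_mat (D11_bar e T N) * A11 T N = transpose_mat (A11 T N * D11_bar e T N)"
    using transpose_mult[OF A11_carrier] by metis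
  then show ?thesis
    using eq_neg_iff_add_eq_0[THEN iffD1, OF gram_dcoef_skew[OF assms]]
    by (intro eq_matI) (auto simp: A11_mult_D11_bar[OF assms])
qed

end
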